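(* Let $(X,|\cdot|)$ be a real Banach space with dual $X^*$, let $J:X\to X^*$ be the duality mapping corresponding to a normalization function $\theta$ with $\theta(1)=1$, and assume that $J$ is single-valued, bijective, and that $J$ and $J^{-1}$ are continuous. Let $E\in C^1(X)$ with $E(0)=0$, let $K\subset X$ be a nondegenerate cone (wedge), $K_1=\{v\in K:|v|=1\}$, and let $0\le r<R\le\infty$. Define $T(u)=J^{-1}(Ju-E'(u))$ and assume that $T(K)\subset K$ and that $T:K\to K$ is completely continuous. Assume also that there exist $r_0>0$ and $R_0<\infty$ with $r\le r_0<R_0\le R$ such that for every $v\in K_1$ the function $t\mapsto E(tv)$ attains its maximum on $[r,R]$ at a unique point $t_v$, and $r_0<t_v<R_0$. Let $U_b=\{t_vv:v\in K_1\}$. Then $E$ has a critical point $u\in U_b$ (that is, $E'(u)=0$), with $u\in K$ and $r<|u|<R$. In addition, for $v=\frac{u}{|u|}$, $u$ maximizes the function $t\mapsto E(tv)$ on $(r,R)$ along its own direction, i.e. this function attains its maximum on $(r,R)$ at $t=|u|$.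
   Context: A nondegenerate cone (wedge) $K$ is a closed convex set with $\lambda K\subset K$ for all $\lambda\ge0$ and $K\setminus\{0\}\ne\emptyset$. Completely continuous means continuous and mapping bounded sets into relatively compact sets. A normalization function is a continuous strictly increasing function $\theta:\mathbb{R}_+\to\mathbb{R}_+$ with $\theta(0)=0$ and $\lim_{t\to\infty}\theta(t)=\infty$. The duality mapping corresponding to $\theta$ is the set-valued map $Jx=\{x^*\in X^*:\langle x^*,x\rangle=\theta(|x|)|x|,\ |x^*|=\theta(|x|)\}$, where $\langle\cdot,\cdot\rangle$ is the duality between $X^*$ and $X$ and $|\cdot|$ also denotes the norm of $X^*$. When $R=\infty$, $[r,R]$ means $[r,\infty)$. *)

theory Defs
  imports "HOL-Analysis.Analysis"
begin

text \<open>Only the values of \<open>\<theta>\<close> on \<open>[0,\<infinity>)\<close> are constrained.\<close>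

definition normalization_function :: "(real \<Rightarrow> real) \<Rightarrow> bool" where
  "normalization_function \<theta> \<longleftrightarrow>
     \<theta> ` {0..} \<subseteq> {0..} \<and> continuous_on {0..} \<theta> \<and> strict_mono_on {0..} \<theta> \<and>
     \<theta> 0 = 0 \<and> filterlim \<theta> at_top at_top"

text \<open>The dual space is the type of bounded linear functionals, with the operator norm.\<close>

definition duality_mapping ::
    "(real \<Rightarrow> real) \<Rightarrow> 'a::real_normed_vector \<Rightarrow> ('a \<Rightarrow>\<^sub>L real) set" where
  "duality_mapping \<theta> x =
     {f. blinfun_apply f x = \<theta> (norm x) * norm x \<and> norm f = \<theta> (norm x)}"

text \<open>A wedge: \<open>K \<inter> - K = {0}\<close> is not required.\<close>

definition nondegenerate_cone :: "'a::real_normed_vector set \<Rightarrow> bool" where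
  "nondegenerate_cone K \<longleftrightarrow> closed K \<and> convex K \<and> cone K \<and> K - {0} \<noteq> {}"

definition completely_continuous_on ::
    "'a::metric_space set \<Rightarrow> ('a \<Rightarrow> 'b::metric_space) \<Rightarrow> bool" where
  "completely_continuous_on S f \<longleftrightarrow>
     continuous_on S f \<and> (\<forall>B\<subseteq>S. bounded B \<longrightarrow> compact (closure (f ` B)))"

end

(* Along each ray the maximality of \<open>\<tau> v\<close> gives \<open>\<langle>E'(u), u\<rangle> = 0\<close> at \<open>u = \<tau> v v\<close>, hence
   \<open>\<langle>J(Tu), u\<rangle> = \<langle>Ju, u\<rangle>\<close>.  Therefore |Tu| \<ge> |u|, and \<open>g v = Tu / |Tu|\<close> is a compact self-map of K_1;
   moreover \<open>Tu = c v\<close> with c > 0 already forces Tu = u, which means E'(u) = 0.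
   If the closed image C of g misses -e for some e in K_1, then sending a point x of the unit ball
   of K to the normalization of \<open>|x| g(x/|x|) + (1 - |x|) e\<close> is well defined, and Schauder's
   theorem yields a fixed point of g.
   Otherwise -K_1 \<subseteq> C \<subseteq> K_1, so K_1 = C is compact and the minimum of \<open>E(\<tau> v v)\<close> is attained.
   There \<open>\<langle>E'(u), h\<rangle> \<ge> 0\<close> for all h in K; taking h = Tu gives \<open>\<langle>J(Tu) - Ju, Tu - u\<rangle> \<le> 0\<close>,
   and J is strictly monotone. *)

theory Submission
  imports Defs
begin

section \<open>Schauder's fixed point theorem, by way of Kuhn's combinatorial lemma\<close>

text \<open>The cube is indexed by an initial segment of the naturals because the library's Brouwer
  theorem fixes the dimension by the type, whereas Schauder's theorem needs arbitrary dimension.\<close>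

lemma approximate_brouwer_cube:
  fixes h :: "(nat \<Rightarrow> real) \<Rightarrow> nat \<Rightarrow> real"
  assumes maps: "\<And>a i. \<forall>i<n. a i \<in> {0..1} \<Longrightarrow> i < n \<Longrightarrow> h a i \<in> {0..1}"
    and unif: "\<And>e. e > 0 \<Longrightarrow> \<exists>d>0. \<forall>a b.
           (\<forall>i<n. a i \<in> {0..1} \<and> b i \<in> {0..1} \<and> \<bar>a i - b i\<bar> < d) \<longrightarrow>
           (\<forall>i<n. \<bar>h a i - h b i\<bar> < e)"
    and "\<epsilon> > 0"
  obtains a where "\<forall>i<n. a i \<in> {0..1}" "\<forall>i<n. \<bar>h a i - a i\<bar> < \<epsilon>"
proof -
  obtain d where "d > 0" and d: "\<And>a b. \<forall>i<n. a i \<in> {0..1} \<and> b i \<in> {0..1} \<and> \<bar>a i - b i\<bar> < d \<Longrightarrow>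
      \<forall>i<n. \<bar>h a i - h b i\<bar> < \<epsilon> / 2"
    using unif[of "\<epsilon> / 2"] \<open>\<epsilon> > 0\<close> by auto
  \<comment> \<open>Grid cells of side \<open>1 / p\<close> are small on two counts:
    \<open>h\<close> varies by less than \<epsilon>/2 across a cell, and so does each
    coordinate.\<close>
  obtain p where p: "p > 0" "1 / real p < min d (\<epsilon> / 2)"
    using nat_approx_posE[of "min d (\<epsilon> / 2)"] \<open>d > 0\<close> \<open>\<epsilon> > 0\<close>
    by (metis half_gt_zero min_less_iff_conj zero_less_Suc)
  define z :: "(nat \<Rightarrow> nat) \<Rightarrow> nat \<Rightarrow> real" where "z x i = x i / p" for x i
  \<comment> \<open>Label 0 says that \<open>h\<close> does not decrease coordinate
    \<open>i\<close>. The clause \<open>x i \<noteq> p\<close> forces label 1 on the upper face, as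
    Kuhn's lemma demands; the lower face gets 0 because \<open>h\<close> is nonnegative
    there.\<close>
  define label :: "(nat \<Rightarrow> nat) \<Rightarrow> nat \<Rightarrow> nat" where
    "label x i = (if x i \<noteq> p \<and> z x i \<le> h (z x) i then 0 else 1)" for x i
  have z01: "\<forall>i<n. z x i \<in> {0..1}" if "\<forall>i<n. x i \<le> p" for x
    using that p by (auto simp: z_def divide_le_eq)
  obtain q where q: "\<forall>i<n. q i < p"
    and rs: "\<forall>i<n. \<exists>r s. (\<forall>j<n. q j \<le> r j \<and> r j \<le> q j + 1) \<and>
                 (\<forall>j<n. q j \<le> s j \<and> s j \<le> q j + 1) \<and> label r i \<noteq> label s i"
  proof (rule kuhn_lemma[of p n label])
    show "\<forall>x. (\<forall>i<n. x i \<le> p) \<longrightarrow> (\<forall>i<n. x i = 0 \<longrightarrow> label x i = 0)"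
    proof (intro allI impI)
      fix x i assume x: "\<forall>i<n. x i \<le> p" and i: "i < n" "x i = 0"
      then have "z x i = 0" by (simp add: z_def)
      then show "label x i = 0"
        using maps[OF z01[OF x] i(1)] i(2) p by (simp add: label_def)
    qed
  qed (use p in \<open>auto simp: label_def\<close>)
  show thesis
  proof
    show zq: "\<forall>i<n. z q i \<in> {0..1}"
      using q by (intro z01) auto
    have near: "\<bar>z q j - z r j\<bar> < min d (\<epsilon> / 2) \<and> z r j \<in> {0..1}"
      if "\<forall>j<n. q j \<le> r j \<and> r j \<le> q j + 1" "j < n" for r j
    proof -
      have "\<bar>real (q j) - real (r j)\<bar> \<le> 1" using that by force
      moreover have "\<bar>z q j - z r j\<bar> = \<bar>real (q j) - real (r j)\<bar> / p"
        by (simp add: z_def diff_divide_distrib[symmetric])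
      ultimately have "\<bar>z q j - z r j\<bar> \<le> 1 / p"
        using p by (simp add: divide_right_mono)
      moreover have "\<forall>j<n. r j \<le> p"
        using that(1) q by (metis Suc_eq_plus1 Suc_leI le_trans)
      ultimately show ?thesis using p z01[of r] that(2) by auto
    qed
    show "\<forall>i<n. \<bar>h (z q) i - z q i\<bar> < \<epsilon>"
    proof (intro allI impI)
      fix i assume i: "i < n"
      have close: "\<bar>h (z q) i - h (z r) i\<bar> < \<epsilon> / 2 \<and> \<bar>z q i - z r i\<bar> < \<epsilon> / 2 \<and> h (z r) i \<in> {0..1} \<and> (r i = p \<longrightarrow> z r i = 1)"
        if r: "\<forall>j<n. q j \<le> r j \<and> r j \<le> q j + 1" for r
      proof (intro conjI impI)
        show "\<bar>h (z q) i - h (z r) i\<bar> < \<epsilon> / 2"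
          using d[of "z q" "z r"] near[OF r] zq i by auto
        show "h (z r) i \<in> {0..1}" using near[OF r] i by (intro maps) auto
      qed (use near[OF r i] p in \<open>auto simp: z_def\<close>)
      \<comment> \<open>Coordinate \<open>i\<close> is not decreased at the vertex \<open>r\<close>
        and not increased at \<open>s\<close>. Both vertices are \<epsilon>/2-close to
        \<open>q\<close> in argument and in value, so the displacement at \<open>q\<close> is below
        \<epsilon>.\<close>
      obtain r s where r: "\<forall>j<n. q j \<le> r j \<and> r j \<le> q j + 1" "label r i = 0"
        and s: "\<forall>j<n. q j \<le> s j \<and> s j \<le> q j + 1" "label s i \<noteq> 0"
        using rs i by (metis (full_types) label_def)
      have "z r i \<le> h (z r) i" using r(2) by (auto simp: label_def split: if_splits)
      moreover have "h (z s) i \<le> z s i"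
        using s(2) close[OF s(1)] by (auto simp: label_def split: if_splits)
      ultimately show "\<bar>h (z q) i - z q i\<bar> < \<epsilon>"
        using close[OF r(1)] close[OF s(1)] unfolding abs_less_iff by linarith
    qed
  qed
qed

text \<open>The denominators are at least 1 and differ by at most \<open>n * d\<close>, so
  normalization is Lipschitz for the maximum distance. This later makes the map from the cube to the
  convex hull Lipschitz.\<close>

lemma normalized_weights_close:
  fixes a b :: "nat \<Rightarrow> real"
  assumes a: "\<forall>i<n. a i \<in> {0..1}" and b: "\<forall>i<n. b i \<in> {0..1}"
    and d: "\<forall>i<n. \<bar>a i - b i\<bar> \<le> d" and i: "i < n"
  shows "\<bar>a i / max 1 (sum a {..<n}) - b i / max 1 (sum b {..<n})\<bar> \<le> (1 + real n) * d"
proof -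
  define s t where "s = max 1 (sum a {..<n})" and "t = max 1 (sum b {..<n})"
  have st: "s \<ge> 1" "t \<ge> 1" by (auto simp: s_def t_def)
  have "\<bar>sum a {..<n} - sum b {..<n}\<bar> \<le> (\<Sum>i<n. \<bar>a i - b i\<bar>)"
    by (metis sum_abs sum_subtractf)
  also have "\<dots> \<le> n * d" using sum_bounded_above[of "{..<n}" "\<lambda>i. \<bar>a i - b i\<bar>" d] d by simp
  finally have nd: "\<bar>s - t\<bar> \<le> n * d" by (auto simp: s_def t_def)
  \<comment> \<open>The numerator is changed first, then the denominator; \<open>b i / t\<close>
    stays in [0,1].\<close>
  have eq: "a i / s - b i / t = (a i - b i) / s + (b i / t) * ((t - s) / s)"
    using st by (simp add: field_simps)
  have "\<bar>(a i - b i) / s\<bar> \<le> \<bar>a i - b i\<bar>"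
    using st by (simp add: divide_le_eq mult_le_cancel_left1)
  moreover have "\<bar>(b i / t) * ((t - s) / s)\<bar> \<le> 1 * \<bar>t - s\<bar>"
    unfolding abs_mult using b i st
    by (intro mult_mono) (auto simp: divide_le_eq mult_le_cancel_left1 intro: order_trans)
  moreover have "\<bar>a i - b i\<bar> \<le> d" using d i by blast
  ultimately have "\<bar>a i / s - b i / t\<bar> \<le> d + n * d"
    using nd abs_triangle_ineq[of "(a i - b i) / s" "(b i / t) * ((t - s) / s)"]
      abs_minus_commute[of s t] unfolding eq by (smt (verit, best))
  then show ?thesis unfolding s_def t_def by (simp add: algebra_simps)
qed

text \<open>Schauder projection: \<open>f\<close> is replaced, up to e/2, by convex combinations of
  a finite e/2-net of \<open>M\<close>. The cube lemma is applied to the coefficients rather than to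
  the points, so affine dependence within the net is harmless.\<close>

lemma approximate_fixed_point:
  fixes f :: "'a::real_normed_vector \<Rightarrow> 'a"
  assumes "convex D" and contf: "continuous_on D f"
    and "compact M" and fM: "f ` D \<subseteq> M" and "M \<subseteq> D" and "D \<noteq> {}" and "e > 0"
  obtains x where "x \<in> D" "norm (f x - x) < e"
proof -
  obtain y0 where "y0 \<in> M" using \<open>D \<noteq> {}\<close> fM by blast
  obtain Y where "finite Y" "Y \<subseteq> M" and cover: "M \<subseteq> (\<Union>y\<in>Y. ball y (e/2))"
    using seq_compact_imp_totally_bounded[of M] compact_imp_seq_compact[OF \<open>compact M\<close>] \<open>e > 0\<close>
    by (meson half_gt_zero)
  obtain n :: nat and y' where Y: "Y = y' ` {i. i < n}"
    using finite_imp_nat_seg_image_inj_on[OF \<open>finite Y\<close>] by blast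
  \<comment> \<open>Index \<open>n\<close> lies outside the enumeration of the net;
    \<open>y0\<close> is a base point in \<open>M\<close> that receives no weight from the functions
    \<open>w\<close>.\<close>
  define y where "y = y'(n := y0)"
  have y: "Y = y ` {..<n}" by (auto simp: Y y_def)
  have yM: "y i \<in> M" if "i \<le> n" for i
    using that \<open>Y \<subseteq> M\<close> \<open>y0 \<in> M\<close> y by (cases "i = n") (auto simp: y_def)
  define Q where "Q = convex hull (y ` {..n})"
  have "compact Q" unfolding Q_def by (simp add: finite_imp_compact_convex_hull)
  have "Q \<subseteq> D"
    unfolding Q_def using yM \<open>M \<subseteq> D\<close> by (intro hull_minimal \<open>convex D\<close>) auto
  \<comment> \<open>Tent functions vanishing outside the e/2-balls about the net points; divided by
    \<open>W\<close> they form a partition of unity on \<open>M\<close>.\<close>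
  define w where "w i z = max 0 (e/2 - dist z (y i))" for i z
  define W where "W z = (\<Sum>i<n. w i z)" for z
  have w0: "w i z \<ge> 0" for i z by (simp add: w_def)
  have Wpos: "W z > 0" if zM: "z \<in> M" for z
  proof -
    obtain i where "i < n" "dist (y i) z < e/2" using subsetD[OF cover zM] y by auto
    then have "w i z > 0" by (simp add: w_def dist_commute)
    then show ?thesis unfolding W_def using w0 \<open>i < n\<close> by (intro sum_pos2[of _ i]) auto
  qed
  define c where "c i x = w i (f x) / W (f x)" for i x
  \<comment> \<open>the missing mass goes to \<open>y n\<close>; when \<open>sum a = 1\<close> this is the plain combination of \<open>y 0, \<dots>, y (n - 1)\<close>\<close>
  define X where "X a = y n + (\<Sum>i<n. (a i / max 1 (sum a {..<n})) *\<^sub>R (y i - y n))" for a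
  have XQ: "X a \<in> Q" if a: "\<forall>i<n. a i \<in> {0..1}" for a
  proof -
    define b where "b i = a i / max 1 (sum a {..<n})" for i
    define b' where "b' = b(n := 1 - sum b {..<n})"
    have sb: "sum b {..<n} = sum a {..<n} / max 1 (sum a {..<n})"
      by (simp add: b_def sum_divide_distrib)
    then have "sum b {..<n} \<le> 1" by (simp add: divide_le_eq)
    moreover have "b i \<ge> 0" if "i < n" for i using a that by (simp add: b_def)
    ultimately have "b' i \<ge> 0" if "i \<in> {..n}" for i using that by (auto simp: b'_def)
    moreover have sb': "sum b' {..<n} = sum b {..<n}" by (auto simp: b'_def intro: sum.cong)
    then have "sum b' {..n} = 1"
      by (simp add: lessThan_Suc_atMost[symmetric] b'_def)
    ultimately have "(\<Sum>i\<in>{..n}. b' i *\<^sub>R y i) \<in> Q"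
      unfolding Q_def by (intro convex_sum) (auto intro: hull_inc)
    also have "(\<Sum>i\<in>{..n}. b' i *\<^sub>R y i) = (\<Sum>i<n. b i *\<^sub>R y i) + (1 - sum b {..<n}) *\<^sub>R y n"
      by (auto simp: lessThan_Suc_atMost[symmetric] b'_def intro: sum.cong)
    also have "\<dots> = X a"
      unfolding X_def b_def[symmetric]
      by (simp add: scaleR_diff_right sum_subtractf scaleR_left.sum[symmetric] scaleR_diff_left)
    finally show ?thesis .
  qed
  define L where "L = (\<Sum>i<n. (1 + real n) * norm (y i - y n))"
  have "L \<ge> 0" unfolding L_def by (intro sum_nonneg) auto
  have lip: "norm (X a - X b) \<le> d * L"
    if "\<forall>i<n. a i \<in> {0..1}" "\<forall>i<n. b i \<in> {0..1}" "\<forall>i<n. \<bar>a i - b i\<bar> \<le> d" for a b d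
  proof -
    have "X a - X b = (\<Sum>i<n. (a i / max 1 (sum a {..<n}) - b i / max 1 (sum b {..<n})) *\<^sub>R (y i - y n))"
      by (simp add: X_def sum_subtractf scaleR_diff_left)
    also have "norm \<dots> \<le> (\<Sum>i<n. (1 + real n) * d * norm (y i - y n))"
      using normalized_weights_close[OF that]
      by (intro sum_norm_le) (auto intro: mult_right_mono)
    finally show ?thesis by (simp add: L_def sum_distrib_left mult_ac)
  qed
  have contc: "continuous_on Q (c i)" for i
  proof -
    have contf: "continuous_on Q f" using contf \<open>Q \<subseteq> D\<close> continuous_on_subset by blast
    have contw: "continuous_on Q (\<lambda>x. w j (f x))" for j
      unfolding w_def by (intro continuous_intros contf)
    then have "continuous_on Q (\<lambda>x. W (f x))"
      unfolding W_def by (intro continuous_on_sum) auto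
    moreover have "\<forall>x\<in>Q. W (f x) \<noteq> 0" using Wpos fM \<open>Q \<subseteq> D\<close> by fastforce
    ultimately show ?thesis unfolding c_def by (intro continuous_on_divide contw)
  qed
  \<comment> \<open>From coefficients to a point, then to the coefficients of the projection of
    \<open>f\<close> at that point. A fixed point of \<open>h\<close> would make \<open>X a\<close>
    the projection of \<open>f (X a)\<close>.\<close>
  define h where "h a i = c i (X a)" for a i
  have c01: "c i x \<in> {0..1}" and c_sum: "(\<Sum>i<n. c i x) = 1" if "x \<in> Q" "i < n" for i x
  proof -
    have W: "W (f x) > 0" using Wpos fM \<open>Q \<subseteq> D\<close> that by blast
    have "w i (f x) \<le> W (f x)" unfolding W_def using w0 that by (intro member_le_sum) auto
    then show "c i x \<in> {0..1}" using W w0 by (simp add: c_def)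
    show "(\<Sum>i<n. c i x) = 1" using W by (simp add: c_def sum_divide_distrib[symmetric] W_def)
  qed
  have unif: "\<exists>d>0. \<forall>a b. (\<forall>i<n. a i \<in> {0..1} \<and> b i \<in> {0..1} \<and> \<bar>a i - b i\<bar> < d) \<longrightarrow>
           (\<forall>i<n. \<bar>h a i - h b i\<bar> < e')" if "e' > 0" for e'
  proof -
    have "\<forall>i. \<exists>d>0. \<forall>x\<in>Q. \<forall>x'\<in>Q. dist x' x < d \<longrightarrow> dist (c i x') (c i x) < e'"
      using compact_uniformly_continuous[OF contc \<open>compact Q\<close>] \<open>e' > 0\<close>
      unfolding uniformly_continuous_on_def by blast
    then obtain d where d: "\<And>i. d i > 0" 
      "\<And>i x x'. x \<in> Q \<Longrightarrow> x' \<in> Q \<Longrightarrow> dist x' x < d i \<Longrightarrow> dist (c i x') (c i x) < e'"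
      by metis
    \<comment> \<open>A common modulus for the finitely many \<open>c i\<close>; the inserted 1
      keeps the minimum meaningful when \<open>n = 0\<close>.\<close>
    define d' where "d' = Min (insert 1 (d ` {..<n}))"
    have "d' > 0" using d by (auto simp: d'_def)
    have d': "d' \<le> d i" if "i < n" for i using that by (auto simp: d'_def)
    show ?thesis
    proof (intro exI conjI allI impI)
      show "d' / (L + 1) > 0" using \<open>d' > 0\<close> \<open>L \<ge> 0\<close> by simp
      fix a b i
      assume ab: "\<forall>i<n. a i \<in> {0..1} \<and> b i \<in> {0..1} \<and> \<bar>a i - b i\<bar> < d' / (L + 1)" and i: "i < n"
      have "dist (X a) (X b) \<le> d' / (L + 1) * L"
        unfolding dist_norm using ab by (intro lip) force+
      also have "\<dots> < d'" using \<open>d' > 0\<close> \<open>L \<ge> 0\<close> by (simp add: field_simps)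
      finally show "\<bar>h a i - h b i\<bar> < e'"
        unfolding h_def dist_real_def[symmetric] using d' i ab by (intro d(2) XQ) force+
    qed
  qed
  \<comment> \<open>The tolerance is such that \<open>lip\<close> turns it into less than e/2;
    \<open>L + 1\<close> covers the case \<open>L = 0\<close>.\<close>
  obtain a where a: "\<forall>i<n. a i \<in> {0..1}" "\<forall>i<n. \<bar>h a i - a i\<bar> < e / (2 * (L + 1))"
  proof (rule approximate_brouwer_cube[of n h "e / (2 * (L + 1))"])
    show "\<And>a i. \<forall>i<n. a i \<in> {0..1} \<Longrightarrow> i < n \<Longrightarrow> h a i \<in> {0..1}"
      unfolding h_def using c01 XQ by blast
  next
    show "e / (2 * (L + 1)) > 0" using \<open>L \<ge> 0\<close> \<open>e > 0\<close> by simp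
  qed (erule unif, rule that)
  have xQ: "X a \<in> Q" using XQ a by blast
  then have fx: "f (X a) \<in> M" using fM \<open>Q \<subseteq> D\<close> by blast
  then have "n > 0" using Wpos[OF fx] by (cases n) (auto simp: W_def)
  have "norm (X (h a) - X a) \<le> e / (2 * (L + 1)) * L"
    using a c01[OF xQ] by (intro lip) (auto simp: h_def intro: less_imp_le)
  also have "\<dots> < e / 2" using \<open>L \<ge> 0\<close> \<open>e > 0\<close> by (simp add: field_simps)
  finally have 1: "norm (X (h a) - X a) < e / 2" .
  have sum_h: "sum (h a) {..<n} = 1" using c_sum[OF xQ \<open>n > 0\<close>] by (simp add: h_def)
  \<comment> \<open>The weights \<open>h a\<close> sum to 1, so dividing by \<open>max 1\<close>
    changes nothing and \<open>y n\<close> cancels. Only net points within e/2 of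
    \<open>f (X a)\<close> carry weight.\<close>
  have "X (h a) - f (X a) = (\<Sum>i<n. h a i *\<^sub>R (y i - f (X a)))"
    by (simp add: X_def sum_h scaleR_diff_right sum_subtractf scaleR_left.sum[symmetric])
  also have "norm \<dots> \<le> (\<Sum>i<n. h a i * (e / 2))"
  proof (rule sum_norm_le)
    fix i assume "i \<in> {..<n}"
    then have "h a i \<ge> 0" using c01[OF xQ] by (simp add: h_def)
    moreover have "norm (y i - f (X a)) \<le> e / 2" if "h a i \<noteq> 0"
      using that by (auto simp: h_def c_def w_def dist_norm norm_minus_commute max_def split: if_splits)
    ultimately show "norm (h a i *\<^sub>R (y i - f (X a))) \<le> h a i * (e / 2)"
      by (cases "h a i = 0") (auto intro: mult_left_mono)
  qed
  also have "\<dots> = e / 2" by (simp only: sum_distrib_right[symmetric] sum_h)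
  finally have "norm (f (X a) - X a) < e"
    using 1 norm_triangle_ineq[of "f (X a) - X (h a)" "X (h a) - X a"]
    by (simp add: norm_minus_commute)
  with xQ \<open>Q \<subseteq> D\<close> show thesis by (intro that) auto
qed

text \<open>Take approximate fixed points with errors tending to 0. Compactness of \<open>M\<close>
  makes their images converge along a subsequence, the points follow to the same limit, and this
  limit lies in \<open>M\<close>, hence in \<open>D\<close>, where \<open>f\<close> is
  continuous.\<close>

theorem schauder:
  fixes f :: "'a::real_normed_vector \<Rightarrow> 'a"
  assumes "convex D" and contf: "continuous_on D f"
    and "compact M" and fM: "f ` D \<subseteq> M" and "M \<subseteq> D" and "D \<noteq> {}"
  obtains x where "x \<in> D" "f x = x"
proof -
  have "\<exists>x. x \<in> D \<and> norm (f x - x) < inverse (real (Suc k))" for k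
    by (rule approximate_fixed_point[OF assms, of "inverse (real (Suc k))"]) auto
  then obtain x where x: "\<And>k. x k \<in> D" "\<And>k. norm (f (x k) - x k) < inverse (real (Suc k))"
    by metis
  have "\<forall>k. f (x k) \<in> M" using x fM by blast
  then obtain m \<rho> where m: "m \<in> M" "strict_mono (\<rho> :: nat \<Rightarrow> nat)" "(\<lambda>k. f (x (\<rho> k))) \<longlonglongrightarrow> m"
    using seq_compactE[OF compact_imp_seq_compact[OF \<open>compact M\<close>], of "\<lambda>k. f (x k)"]
    by (auto simp: o_def)
  have "(\<lambda>k. f (x k) - x k) \<longlonglongrightarrow> 0"
    using x(2) by (intro Lim_null_comparison[OF _ LIMSEQ_inverse_real_of_nat]) (auto intro: less_imp_le always_eventually)
  then have "(\<lambda>k. f (x (\<rho> k)) - x (\<rho> k)) \<longlonglongrightarrow> 0"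
    using LIMSEQ_subseq_LIMSEQ[OF _ m(2)] by (force simp: o_def)
  from tendsto_diff[OF m(3) this] have "(\<lambda>k. x (\<rho> k)) \<longlonglongrightarrow> m" by simp
  then have "(\<lambda>k. f (x (\<rho> k))) \<longlonglongrightarrow> f m"
    using contf x(1) m(1) \<open>M \<subseteq> D\<close> by (intro continuous_on_tendsto_compose[OF contf]) auto
  then show thesis using that m \<open>M \<subseteq> D\<close> LIMSEQ_unique by blast
qed

section \<open>Fixed points on the unit section of a cone\<close>

text \<open>\<open>S\<close> need not be convex, but the part of \<open>K\<close> in the closed unit
  ball is. The map is extended to that part with values in \<open>S\<close>, so Schauder's fixed
  point has norm 1, where the extension agrees with \<open>g\<close>.\<close>

lemma unit_section_fixed_point:
  fixes g :: "'a::real_normed_vector \<Rightarrow> 'a"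
  assumes "convex K" and "cone K" and S: "S = {v \<in> K. norm v = 1}"
    and contg: "continuous_on S g" and "compact C" and gC: "g ` S \<subseteq> C" and "C \<subseteq> S"
    and "e \<in> S" and "- e \<notin> C"
  obtains v where "v \<in> S" "g v = v"
proof -
  define F where "F c s = s *\<^sub>R c + (1 - s) *\<^sub>R e" for c :: 'a and s
  \<comment> \<open>At \<open>x = 0\<close> the value \<open>g 0\<close> is unconstrained, but the
    factor \<open>norm x\<close> removes it and \<open>\<Phi> 0 = sgn e\<close>.\<close>
  define \<Phi> where "\<Phi> x = sgn (F (g (sgn x)) (norm x))" for x
  define D where "D = K \<inter> cball 0 1"
  define M where "M = (\<lambda>(c, s). sgn (F c s)) ` (C \<times> {0..1})"
  have sgnS: "sgn x \<in> S" if "x \<in> K" "x \<noteq> 0" for x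
    using that \<open>cone K\<close> by (auto simp: S sgn_div_norm cone_def)
  \<comment> \<open>A convex combination of two unit vectors vanishes only at the midpoint of an
    antipodal pair.\<close>
  have F0: "F c s \<noteq> 0" if "c \<in> C" "s \<in> {0..1}" for c s
  proof
    assume 0: "F c s = 0"
    have n: "norm c = 1" "norm e = 1" using that \<open>C \<subseteq> S\<close> \<open>e \<in> S\<close> by (auto simp: S)
    from 0 have eq: "s *\<^sub>R c = - ((1 - s) *\<^sub>R e)" by (simp add: F_def eq_neg_iff_add_eq_0)
    then have "norm (s *\<^sub>R c) = norm ((1 - s) *\<^sub>R e)" by simp
    then have "s = 1/2" using n that(2) by simp
    with eq have "(1/2) *\<^sub>R c = (1/2) *\<^sub>R (- e)" by simp
    then have "c = - e" by (subst (asm) scaleR_cancel_left) simp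
    with that(1) \<open>- e \<notin> C\<close> show False by simp
  qed
  have FK: "F c s \<in> K" if "c \<in> C" "s \<in> {0..1}" for c s
    unfolding F_def using that \<open>C \<subseteq> S\<close> \<open>e \<in> S\<close> \<open>convex K\<close> by (auto simp: S intro!: convexD)
  have "compact M"
    unfolding M_def
  proof (intro compact_continuous_image compact_Times \<open>compact C\<close>)
    show "continuous_on (C \<times> {0..1}) (\<lambda>(c, s). sgn (F c s))"
      using F0 unfolding F_def case_prod_beta
      by (intro continuous_intros) (simp_all add: mem_Times_iff)
  qed simp
  have "M \<subseteq> S" unfolding M_def using F0 FK sgnS by auto
  have "S \<subseteq> D" by (auto simp: S D_def)
  have "g e \<in> C" using gC \<open>e \<in> S\<close> by blast
  have \<Phi>M: "\<Phi> ` D \<subseteq> M"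
  proof (rule image_subsetI)
    fix x assume x: "x \<in> D"
    show "\<Phi> x \<in> M"
    proof (cases "x = 0")
      case True
      then have "\<Phi> x = sgn (F (g e) 0)" by (simp add: \<Phi>_def F_def)
      then show ?thesis using \<open>g e \<in> C\<close> unfolding M_def by force
    next
      case False
      then have "g (sgn x) \<in> C" using sgnS gC x by (auto simp: D_def)
      then show ?thesis using x unfolding M_def \<Phi>_def D_def by force
    qed
  qed
  \<comment> \<open>Continuity at 0 cannot come from \<open>sgn\<close>; it holds because
    \<open>g\<close> has unit values on \<open>S\<close>, so the product has norm at most
    \<open>norm x\<close>.\<close>
  have cont: "continuous_on D (\<lambda>x. norm x *\<^sub>R g (sgn x))"
    unfolding continuous_on_eq_continuous_within
  proof
    fix x assume x: "x \<in> D"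
    show "continuous (at x within D) (\<lambda>x. norm x *\<^sub>R g (sgn x))"
    proof (cases "x = 0")
      case True
      have "\<forall>\<^sub>F y in at 0 within D. norm (norm y *\<^sub>R g (sgn y)) \<le> norm y"
        unfolding eventually_at_filter
      proof (intro always_eventually allI impI)
        fix y assume "y \<noteq> 0" "y \<in> D"
        then have "g (sgn y) \<in> S" using sgnS gC \<open>C \<subseteq> S\<close> by (auto simp: D_def)
        then show "norm (norm y *\<^sub>R g (sgn y)) \<le> norm y" by (simp add: S)
      qed
      moreover have "((\<lambda>y. norm y) \<longlongrightarrow> 0) (at (0::'a) within D)"
        by (intro tendsto_norm_zero tendsto_ident_at)
      ultimately show ?thesis
        using True unfolding continuous_within by (auto intro: Lim_null_comparison)
    next
      case False
      have "continuous_on (D - {0}) sgn" by (intro continuous_intros) auto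
      moreover have "sgn ` (D - {0}) \<subseteq> S" using sgnS by (auto simp: D_def)
      ultimately have "continuous_on (D - {0}) (\<lambda>x. norm x *\<^sub>R g (sgn x))"
        by (intro continuous_on_scaleR continuous_on_norm continuous_on_id continuous_on_compose2[OF contg])
      then have "continuous (at x within (D - {0})) (\<lambda>x. norm x *\<^sub>R g (sgn x))"
        using x False by (simp add: continuous_on_eq_continuous_within)
      also have "at x within (D - {0}) = at x within D"
        using False by (intro at_within_nhd[of x "- {0}"]) auto
      finally show ?thesis .
    qed
  qed
  have F\<Phi>: "F (g (sgn x)) (norm x) \<noteq> 0" if "x \<in> D" for x
  proof (cases "x = 0")
    case True
    then show ?thesis using F0[OF \<open>g e \<in> C\<close>, of 0] by (simp add: F_def)
  next
    case False
    then show ?thesis using that sgnS gC by (intro F0) (auto simp: D_def)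
  qed
  have "continuous_on D \<Phi>"
    unfolding \<Phi>_def F_def
  proof (intro continuous_on_sgn continuous_on_add cont)
    show "continuous_on D (\<lambda>x. (1 - norm x) *\<^sub>R e)" by (intro continuous_intros)
  qed (use F\<Phi> in \<open>auto simp: F_def\<close>)
  moreover have "convex D" unfolding D_def by (intro convex_Int \<open>convex K\<close> convex_cball)
  ultimately obtain x where x: "x \<in> D" "\<Phi> x = x"
    using schauder[OF _ _ \<open>compact M\<close> \<Phi>M] \<open>M \<subseteq> S\<close> \<open>S \<subseteq> D\<close> \<open>e \<in> S\<close> by blast
  then have "x \<in> S" using \<Phi>M \<open>M \<subseteq> S\<close> by force
  then have "sgn x = x" "norm x = 1" by (auto simp: S sgn_div_norm)
  moreover have "g x \<in> S" using gC \<open>C \<subseteq> S\<close> \<open>x \<in> S\<close> by blast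
  ultimately have "g x = x" using x(2) by (simp add: \<Phi>_def F_def sgn_div_norm S)
  with \<open>x \<in> S\<close> show thesis by (rule that)
qed

section \<open>Ray maximizers, monotonicity of the duality mapping, and minima over ray
  maxima\<close>

text \<open>A closed graph argument: the preimage of a closed \<open>U\<close> in \<open>C\<close>
  is the projection to \<open>S\<close> of the maximizing pairs in \<open>S \<times> U\<close>, and
  projection along a compact factor is a closed map.\<close>

lemma continuous_on_unique_maximizer:
  fixes F :: "'a::topological_space \<Rightarrow> 'b::t2_space \<Rightarrow> real"
  assumes cont: "continuous_on (S \<times> I) (\<lambda>z. F (fst z) (snd z))"
    and "compact C" and "C \<subseteq> I" and \<tau>C: "\<And>v. v \<in> S \<Longrightarrow> \<tau> v \<in> C"
    and max: "\<And>v t. v \<in> S \<Longrightarrow> t \<in> I \<Longrightarrow> F v t \<le> F v (\<tau> v)"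
    and unique: "\<And>v t. v \<in> S \<Longrightarrow> t \<in> I \<Longrightarrow> \<forall>s\<in>I. F v s \<le> F v t \<Longrightarrow> t = \<tau> v"
  shows "continuous_on S \<tau>"
proof (cases "S = {}")
  case False
  then have "I \<noteq> {}" using \<tau>C \<open>C \<subseteq> I\<close> by blast
  have "\<tau> \<in> S \<rightarrow> C" using \<tau>C by blast
  then show ?thesis
  proof (rule continuous_on_closed_gen[THEN iffD2], intro allI impI)
    fix U assume U: "closedin (top_of_set C) U"
    then have "U \<subseteq> C" "compact U"
      using \<open>compact C\<close> by (auto dest: closedin_imp_subset closedin_compact)
    \<comment> \<open>Pairs \<open>(v, t)\<close> in which \<open>t\<close> does at least as well as
      the competitor \<open>s\<close>; the intersection over all \<open>s\<close> leaves the pairs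
      with \<open>t\<close> maximal.\<close>
    define G where "G s = S \<times> U \<inter> (\<lambda>z. F (fst z) (snd z) - F (fst z) s) -` {0..}" for s
    have "closedin (top_of_set (S \<times> U)) (\<Inter>s\<in>I. G s)"
    proof (rule closedin_INT[OF \<open>I \<noteq> {}\<close>])
      fix s assume "s \<in> I"
      have "continuous_on (S \<times> U) (\<lambda>z. F (fst z) (snd z))"
        using \<open>U \<subseteq> C\<close> \<open>C \<subseteq> I\<close> by (intro continuous_on_subset[OF cont]) auto
      moreover have "continuous_on (S \<times> U) (\<lambda>z. F (fst (fst z, s)) (snd (fst z, s)))"
        using \<open>s \<in> I\<close> by (intro continuous_on_compose2[OF cont] continuous_intros) auto
      ultimately show "closedin (top_of_set (S \<times> U)) (G s)"
        unfolding G_def by (intro continuous_closedin_preimage continuous_on_diff) auto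
    qed
    moreover have "closed_map (top_of_set (S \<times> U)) (top_of_set S) fst"
      using closed_map_fst[of "top_of_set U" "top_of_set S"] \<open>compact U\<close>
      by (simp add: compact_space_subtopology)
    ultimately have "closedin (top_of_set S) (fst ` (\<Inter>s\<in>I. G s))"
      by (simp add: closed_map_def)
    also have "fst ` (\<Inter>s\<in>I. G s) = S \<inter> \<tau> -` U"
    proof (intro equalityI subsetI)
      fix v assume "v \<in> fst ` (\<Inter>s\<in>I. G s)"
      then obtain t where t: "\<forall>s\<in>I. (v, t) \<in> G s" by auto
      then have "t \<in> U" using \<open>I \<noteq> {}\<close> by (auto simp: G_def)
      from t have "v \<in> S" "\<forall>s\<in>I. F v s \<le> F v t" using \<open>I \<noteq> {}\<close> by (auto simp: G_def)
      with unique[of v t] \<open>t \<in> U\<close> \<open>U \<subseteq> C\<close> \<open>C \<subseteq> I\<close> show "v \<in> S \<inter> \<tau> -` U" by blast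
    next
      fix v assume "v \<in> S \<inter> \<tau> -` U"
      then have "(v, \<tau> v) \<in> (\<Inter>s\<in>I. G s)" using max by (auto simp: G_def)
      then show "v \<in> fst ` (\<Inter>s\<in>I. G s)" by force
    qed
    finally show "closedin (top_of_set S) (S \<inter> \<tau> -` U)" .
  qed
qed simp

text \<open>Strict monotonicity of \<theta> first forces equal norms. Then both pairing bounds are
  equalities, so \<open>J x\<close> lies in the duality set of \<open>y\<close>, which is
  \<open>{J y}\<close>.\<close>

lemma duality_mapping_strictly_monotone:
  assumes mono: "strict_mono_on {0..} \<theta>" and J: "\<And>x. duality_mapping \<theta> x = {J x}" and "inj J"
    and le: "blinfun_apply (J x - J y) (x - y) \<le> 0"
  shows "x = y"
proof -
  have pair: "blinfun_apply (J z) z = \<theta> (norm z) * norm z" and nJ: "norm (J z) = \<theta> (norm z)" for z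
    using J[of z] by (auto simp: duality_mapping_def set_eq_iff)
  have xy: "blinfun_apply (J x) y \<le> \<theta> (norm x) * norm y" for x y
    using norm_blinfun[of "J x" y] nJ[of x] by simp
  have sum: "\<theta> (norm x) * norm x + \<theta> (norm y) * norm y \<le> blinfun_apply (J x) y + blinfun_apply (J y) x"
    using le by (simp add: blinfun.diff_left blinfun.diff_right pair)
  then have prod: "(\<theta> (norm x) - \<theta> (norm y)) * (norm x - norm y) \<le> 0"
    using xy[of x y] xy[of y x] by (simp add: algebra_simps)
  have eq: "norm x = norm y"
  proof (rule ccontr)
    assume "norm x \<noteq> norm y"
    then have "(\<theta> (norm x) - \<theta> (norm y)) * (norm x - norm y) > 0"
      using strict_mono_onD[OF mono, of "norm x" "norm y"] strict_mono_onD[OF mono, of "norm y" "norm x"]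
      by (cases "norm x < norm y") (auto intro: mult_neg_neg mult_pos_pos)
    with prod show False by simp
  qed
  then have "blinfun_apply (J x) y = \<theta> (norm y) * norm y"
    using sum xy[of x y] xy[of y x] unfolding eq by linarith
  then have "J x \<in> duality_mapping \<theta> y"
    using nJ[of x] eq by (simp add: duality_mapping_def)
  with J have "J x = J y" by simp
  with \<open>inj J\<close> show ?thesis by (simp add: inj_eq)
qed

text \<open>If \<open>h\<close> were a descent direction at \<open>u\<close>, a small step from
  \<open>t s *\<^sub>R v\<close> to \<open>t s *\<^sub>R w s\<close> would lower \<open>E\<close>.
  The start is at most \<open>E u\<close> by maximality on the ray and the end is a ray maximum, so
  the latter would fall below the minimum.\<close>

lemma minimax_derivative_nonneg:
  fixes E :: "'a::real_normed_vector \<Rightarrow> real"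
  assumes deriv: "\<And>x. (E has_derivative blinfun_apply (E' x)) (at x)"
    and contE': "continuous_on UNIV E'"
    and "convex K" and "cone K" and S: "S = {v \<in> K. norm v = 1}"
    and cont\<tau>: "continuous_on S \<tau>" and v: "v \<in> S"
    and "0 \<le> a" and a: "a < \<tau> v" and b: "\<tau> v < b"
    and max: "\<And>t. a < t \<Longrightarrow> t < b \<Longrightarrow> E (t *\<^sub>R v) \<le> E (\<tau> v *\<^sub>R v)"
    and min: "\<And>w. w \<in> S \<Longrightarrow> E (\<tau> v *\<^sub>R v) \<le> E (\<tau> w *\<^sub>R w)"
    and "h \<in> K"
  shows "blinfun_apply (E' (\<tau> v *\<^sub>R v)) h \<ge> 0"
proof (rule ccontr)
  define u where "u = \<tau> v *\<^sub>R v"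
  assume "\<not> ?thesis"
  then have neg: "blinfun_apply (E' u) h < 0" by (simp add: u_def)
  have vK: "v \<in> K" "norm v = 1" using v by (auto simp: S)
  have "continuous_on UNIV (\<lambda>x. blinfun_apply (E' x) h)" by (intro continuous_intros contE')
  then have "open {x. blinfun_apply (E' x) h < 0}"
    by (intro open_Collect_less continuous_on_const)
  then obtain \<delta> where "\<delta> > 0" and \<delta>: "\<And>x. dist x u < \<delta> \<Longrightarrow> blinfun_apply (E' x) h < 0"
    using neg unfolding open_dist by blast
  define w where "w s = v + s *\<^sub>R h" for s :: real
  define p where "p s = inverse (norm (w s)) *\<^sub>R w s" for s
  \<comment> \<open>chosen so that \<open>t s *\<^sub>R w s\<close> lies on the manifold of ray maxima; comparing with \<open>t s *\<^sub>R v\<close>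
      avoids differentiating the norm and \<open>\<tau>\<close>\<close>
  define t where "t s = \<tau> (p s) / norm (w s)" for s
  have w: "(w \<longlongrightarrow> v) (at_right 0)"
    unfolding w_def by (rule tendsto_eq_intros tendsto_ident_at refl | simp)+
  then have nw: "((\<lambda>s. norm (w s)) \<longlongrightarrow> 1) (at_right 0)"
    using tendsto_norm[OF w] vK by simp
  have p: "(p \<longlongrightarrow> v) (at_right 0)"
    unfolding p_def using tendsto_scaleR[OF tendsto_inverse[OF nw] w] by simp
  have pS: "\<forall>\<^sub>F s in at_right 0. p s \<in> S"
    using order_tendstoD(1)[OF nw zero_less_one] eventually_at_right_less[of 0]
  proof eventually_elim
    case (elim s)
    have "w s \<in> K"
      unfolding w_def using convex_cone[of K] \<open>cone K\<close> \<open>convex K\<close> vK \<open>h \<in> K\<close> elim(2)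
      by simp
    then show ?case using elim \<open>cone K\<close> by (auto simp: p_def S cone_def)
  qed
  have "((\<lambda>s. \<tau> (p s)) \<longlongrightarrow> \<tau> v) (at_right 0)"
    by (rule continuous_on_tendsto_compose[OF cont\<tau> p v pS])
  from tendsto_divide[OF this nw] have t: "(t \<longlongrightarrow> \<tau> v) (at_right 0)"
    by (simp add: t_def[abs_def])
  \<comment> \<open>This quantity bounds the distance from \<open>u\<close> to every point of the
    segment from \<open>t s *\<^sub>R v\<close> to \<open>t s *\<^sub>R w s\<close>; below \<delta>
    it keeps the derivative along \<open>h\<close> negative on the whole segment.\<close>
  have "((\<lambda>s. norm (t s *\<^sub>R v - u) + t s * s * norm h) \<longlongrightarrow>
         norm (\<tau> v *\<^sub>R v - u) + \<tau> v * 0 * norm h) (at_right 0)"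
    by (intro tendsto_intros t tendsto_ident_at)
  then have "((\<lambda>s. norm (t s *\<^sub>R v - u) + t s * s * norm h) \<longlongrightarrow> 0) (at_right 0)"
    by (simp add: u_def)
  from order_tendstoD(2)[OF this \<open>\<delta> > 0\<close>] order_tendstoD(1)[OF t a] order_tendstoD(2)[OF t b] pS
    order_tendstoD(1)[OF nw zero_less_one] eventually_at_right_less[of 0]
  have "\<forall>\<^sub>F s in at_right 0. norm (t s *\<^sub>R v - u) + t s * s * norm h < \<delta> \<and>
      a < t s \<and> t s < b \<and> p s \<in> S \<and> 0 < norm (w s) \<and> 0 < s"
    by eventually_elim simp
  then obtain s where s: "norm (t s *\<^sub>R v - u) + t s * s * norm h < \<delta>"
      "a < t s" "t s < b" "p s \<in> S" "0 < norm (w s)" "0 < s"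
    using eventually_happens'[OF trivial_limit_at_right_real] by blast
  have "0 < t s * s" using s \<open>0 \<le> a\<close> by simp
  define \<phi> where "\<phi> x = E (t s *\<^sub>R v + x *\<^sub>R h)" for x
  have "DERIV \<phi> x :> blinfun_apply (E' (t s *\<^sub>R v + x *\<^sub>R h)) h" for x
  proof -
    have "((\<lambda>x. E (t s *\<^sub>R v + x *\<^sub>R h)) has_derivative
        (\<lambda>y. blinfun_apply (E' (t s *\<^sub>R v + x *\<^sub>R h)) (y *\<^sub>R h))) (at x)"
      by (rule has_derivative_compose[OF _ deriv]) (auto intro!: derivative_eq_intros)
    then show ?thesis
      by (simp add: \<phi>_def[abs_def] has_field_derivative_def blinfun.scaleR_right mult.commute[of _ "blinfun_apply _ _"])
  qed
  then obtain x where x: "0 < x" "x < t s * s"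
    and mvt: "\<phi> (t s * s) - \<phi> 0 = t s * s * blinfun_apply (E' (t s *\<^sub>R v + x *\<^sub>R h)) h"
    using MVT2[OF \<open>0 < t s * s\<close>, of \<phi> "\<lambda>x. blinfun_apply (E' (t s *\<^sub>R v + x *\<^sub>R h)) h"] by auto
  have "dist (t s *\<^sub>R v + x *\<^sub>R h) u \<le> norm (t s *\<^sub>R v - u) + norm (x *\<^sub>R h)"
    using norm_triangle_ineq[of "t s *\<^sub>R v - u" "x *\<^sub>R h"] by (simp add: dist_norm algebra_simps)
  also have "norm (x *\<^sub>R h) \<le> t s * s * norm h" using x by (simp add: mult_right_mono)
  finally have "dist (t s *\<^sub>R v + x *\<^sub>R h) u < \<delta>" using s by linarith
  with \<delta> mvt \<open>0 < t s * s\<close> have "\<phi> (t s * s) < \<phi> 0"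
    by (smt (verit, best) mult_pos_neg)
  moreover have "\<phi> (t s * s) = E (\<tau> (p s) *\<^sub>R p s)"
    by (simp add: \<phi>_def t_def p_def w_def[symmetric] scaleR_scaleR[symmetric] scaleR_add_right[symmetric] divide_inverse del: scaleR_scaleR)
  moreover have "\<phi> 0 \<le> E u" using max s by (simp add: \<phi>_def u_def)
  ultimately show False using min s by (force simp: u_def)
qed

section \<open>Existence of a critical point among the ray maxima\<close>

theorem corollary1:
  fixes \<theta> :: "real \<Rightarrow> real"
    and J :: "'a::banach \<Rightarrow> ('a \<Rightarrow>\<^sub>L real)"
    and E :: "'a \<Rightarrow> real"
    and E' :: "'a \<Rightarrow> ('a \<Rightarrow>\<^sub>L real)"
    and T :: "'a \<Rightarrow> 'a"
    and K K\<^sub>1 U\<^sub>b :: "'a set"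
    and r r\<^sub>0 R\<^sub>0 :: real
    and R :: ereal
    and \<tau> :: "'a \<Rightarrow> real"
  assumes "normalization_function \<theta>" and "\<theta> 1 = 1"
    and "\<And>x. duality_mapping \<theta> x = {J x}"
    and "bij J" and "continuous_on UNIV J" and "continuous_on UNIV (inv J)"
    and "\<And>x. (E has_derivative blinfun_apply (E' x)) (at x)"
    and "continuous_on UNIV E'"
    and "E 0 = 0"
    and "nondegenerate_cone K"
    and "K\<^sub>1 = {v \<in> K. norm v = 1}"
    and "0 \<le> r" and "ereal r < R"
    and "\<And>u. T u = inv J (J u - E' u)"
    and "T ` K \<subseteq> K"
    and "completely_continuous_on K T"
    and "0 < r\<^sub>0" and "r \<le> r\<^sub>0" and "r\<^sub>0 < R\<^sub>0" and "ereal R\<^sub>0 \<le> R"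
    and "\<And>v. v \<in> K\<^sub>1 \<Longrightarrow>
           is_arg_max (\<lambda>t. E (t *\<^sub>R v)) (\<lambda>t. r \<le> t \<and> ereal t \<le> R) (\<tau> v)"
    and "\<And>v s. v \<in> K\<^sub>1 \<Longrightarrow>
           is_arg_max (\<lambda>t. E (t *\<^sub>R v)) (\<lambda>t. r \<le> t \<and> ereal t \<le> R) s \<Longrightarrow> s = \<tau> v"
    and "\<And>v. v \<in> K\<^sub>1 \<Longrightarrow> r\<^sub>0 < \<tau> v \<and> \<tau> v < R\<^sub>0"
    and "U\<^sub>b = {\<tau> v *\<^sub>R v | v. v \<in> K\<^sub>1}"
  shows "\<exists>u \<in> U\<^sub>b. E' u = 0 \<and> u \<in> K \<and> r < norm u \<and> ereal (norm u) < R \<and>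
           is_arg_max (\<lambda>t. E (t *\<^sub>R (u /\<^sub>R norm u))) (\<lambda>t. r < t \<and> ereal t < R) (norm u)"
proof -
  note mono = assms(1)[unfolded normalization_function_def, THEN conjunct2, THEN conjunct2, THEN conjunct1]
  note deriv = assms(7) and S = assms(11) and T = assms(14) and bounds = assms(23)
  have K: "closed K" "convex K" "cone K" "K - {0} \<noteq> {}"
    using assms(10) by (auto simp: nondegenerate_cone_def)
  have TK: "T x \<in> K" if "x \<in> K" for x using assms(15) that by blast
  have contT: "continuous_on K T" and compT: "\<And>B. B \<subseteq> K \<Longrightarrow> bounded B \<Longrightarrow> compact (closure (T ` B))"
    using assms(16) by (auto simp: completely_continuous_on_def)
  have pair: "blinfun_apply (J x) x = \<theta> (norm x) * norm x" and nJ: "norm (J x) = \<theta> (norm x)" for x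
    using assms(3)[of x] by (auto simp: duality_mapping_def set_eq_iff)
  have JT: "J (T x) = J x - E' x" for x
    unfolding T using \<open>bij J\<close> by (simp add: bij_is_surj surj_f_inv_f)
  define I where "I = {t. r \<le> t \<and> ereal t \<le> R}"
  have I: "t \<in> I" if "r\<^sub>0 \<le> t" "t \<le> R\<^sub>0" for t
  proof -
    have "ereal t \<le> R" using that \<open>ereal R\<^sub>0 \<le> R\<close> by (metis ereal_less_eq(3) order_trans)
    then show ?thesis using that \<open>r \<le> r\<^sub>0\<close> by (simp add: I_def)
  qed
  have max: "E (t *\<^sub>R v) \<le> E (\<tau> v *\<^sub>R v)" if "v \<in> K\<^sub>1" "t \<in> I" for v t
    using assms(21)[OF that(1)] that(2) unfolding is_arg_max_def I_def by (simp add: not_less)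
  define N where "N v = \<tau> v *\<^sub>R v" for v
  have NK: "N v \<in> K" and nN: "norm (N v) = \<tau> v" and \<tau>pos: "\<tau> v > 0" and sgnN: "sgn (N v) = v"
    if "v \<in> K\<^sub>1" for v
    using that bounds[OF that] \<open>0 < r\<^sub>0\<close> \<open>cone K\<close> by (auto simp: N_def S cone_def sgn_div_norm)
  have contE: "continuous_on UNIV E"
    using deriv by (meson continuous_at_imp_continuous_on has_derivative_continuous)
  have cont\<tau>: "continuous_on K\<^sub>1 \<tau>"
  \<comment> \<open>\<open>I\<close> may be unbounded; the interval from \<open>r\<^sub>0\<close> to
    \<open>R\<^sub>0\<close> supplies the compact set.\<close>
  proof (rule continuous_on_unique_maximizer[where F = "\<lambda>v t. E (t *\<^sub>R v)" and I = I and C = "{r\<^sub>0..R\<^sub>0}"])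
    show "continuous_on (K\<^sub>1 \<times> I) (\<lambda>z. E (snd z *\<^sub>R fst z))"
      by (intro continuous_on_compose2[OF contE] continuous_intros) auto
    show "{r\<^sub>0..R\<^sub>0} \<subseteq> I" using I by auto
    show "\<And>v. v \<in> K\<^sub>1 \<Longrightarrow> \<tau> v \<in> {r\<^sub>0..R\<^sub>0}" using bounds by force
    show "t = \<tau> v" if "v \<in> K\<^sub>1" "t \<in> I" "\<forall>s\<in>I. E (s *\<^sub>R v) \<le> E (t *\<^sub>R v)" for v t
      using that by (intro assms(22)) (auto simp: is_arg_max_def I_def not_less)
  qed (auto intro: max)
  have contN: "continuous_on K\<^sub>1 N"
    unfolding N_def by (intro continuous_intros cont\<tau>)

  \<comment> \<open>Vanishing radial derivative and growth of the norm under
    \<open>T\<close>\<close>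
  have radial: "blinfun_apply (E' (N v)) (N v) = 0" if v: "v \<in> K\<^sub>1" for v
  proof -
    have "((\<lambda>t. E (t *\<^sub>R v)) has_derivative (\<lambda>s. blinfun_apply (E' (N v)) (s *\<^sub>R v))) (at (\<tau> v))"
      unfolding N_def by (rule has_derivative_compose[OF _ deriv]) (auto intro!: derivative_eq_intros)
    then have "DERIV (\<lambda>t. E (t *\<^sub>R v)) (\<tau> v) :> blinfun_apply (E' (N v)) v"
      by (simp add: has_field_derivative_def blinfun.scaleR_right mult.commute[of _ "blinfun_apply _ _"])
    then have "blinfun_apply (E' (N v)) v = 0"
    proof (rule DERIV_local_max)
      show "0 < min (\<tau> v - r\<^sub>0) (R\<^sub>0 - \<tau> v)" using bounds[OF v] by simp
    qed (auto intro!: max[OF v] I)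
    then show ?thesis by (simp add: N_def[of v] blinfun.scaleR_right)
  qed
  have normT: "\<tau> v \<le> norm (T (N v))" if v: "v \<in> K\<^sub>1" for v
  proof -
    \<comment> \<open>By \<open>radial\<close>, replacing \<open>J (N v)\<close> by
      \<open>J (T (N v))\<close> does not change the pairing with \<open>N v\<close>.\<close>
    have "\<theta> (\<tau> v) * \<tau> v = blinfun_apply (J (T (N v))) (N v)"
      by (simp add: JT blinfun.diff_left radial[OF v] pair nN[OF v])
    also have "\<dots> \<le> \<theta> (norm (T (N v))) * \<tau> v"
      using norm_blinfun[of "J (T (N v))" "N v"] by (simp add: nJ nN[OF v])
    finally have "\<theta> (\<tau> v) \<le> \<theta> (norm (T (N v)))" using \<tau>pos[OF v] by simp
    then show ?thesis
      using strict_mono_on_less_eq[OF mono, of "\<tau> v" "norm (T (N v))"] \<tau>pos[OF v] by simp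
  qed

  \<comment> \<open>A fixed point of \<open>T\<close> among the ray maxima\<close>
  have "\<exists>v\<in>K\<^sub>1. T (N v) = N v"
  proof -
    define C where "C = sgn ` closure (T ` N ` K\<^sub>1)"
    \<comment> \<open>The lower bound \<open>r\<^sub>0\<close> on the norm passes to the closure,
      which therefore avoids 0, so \<open>sgn\<close> is continuous on it.\<close>
    have "closed (K \<inter> {y. r\<^sub>0 \<le> norm y})"
      by (intro closed_Int closed_Collect_le continuous_intros \<open>closed K\<close>)
    moreover have "T (N v) \<in> K \<and> r\<^sub>0 \<le> norm (T (N v))" if v: "v \<in> K\<^sub>1" for v
      using TK[OF NK[OF v]] normT[OF v] bounds[OF v] by linarith
    then have "T ` N ` K\<^sub>1 \<subseteq> K \<inter> {y. r\<^sub>0 \<le> norm y}" by blast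
    ultimately have cl: "closure (T ` N ` K\<^sub>1) \<subseteq> K \<inter> {y. r\<^sub>0 \<le> norm y}"
      by (rule closure_minimal[rotated])
    have "bounded (N ` K\<^sub>1)"
      using nN bounds by (intro boundedI[of _ R\<^sub>0]) (auto simp: less_imp_le)
    then have "compact (closure (T ` N ` K\<^sub>1))" using NK by (intro compT) auto
    then have "compact C"
      unfolding C_def using cl \<open>0 < r\<^sub>0\<close>
      by (intro compact_continuous_image continuous_on_sgn continuous_on_id) auto
    have "C \<subseteq> K\<^sub>1"
    proof
      fix x assume "x \<in> C"
      then obtain y where "x = sgn y" "y \<in> K" "y \<noteq> 0"
        using subsetD[OF cl] \<open>0 < r\<^sub>0\<close> unfolding C_def by fastforce
      then show "x \<in> K\<^sub>1" using \<open>cone K\<close> by (auto simp: S sgn_div_norm cone_def)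
    qed
    define g where "g v = sgn (T (N v))" for v
    have gC: "g ` K\<^sub>1 \<subseteq> C"
      unfolding g_def C_def by (auto intro!: imageI closure_subset[THEN subsetD])
    have "continuous_on K\<^sub>1 (\<lambda>v. T (N v))"
      using NK by (intro continuous_on_compose2[OF contT contN]) auto
    moreover have "T (N v) \<noteq> 0" if "v \<in> K\<^sub>1" for v
      using normT[OF that] \<tau>pos[OF that] by (metis norm_zero linorder_not_le)
    then have "\<forall>v\<in>K\<^sub>1. T (N v) \<noteq> 0" by blast
    ultimately have contg: "continuous_on K\<^sub>1 g" unfolding g_def by (rule continuous_on_sgn)
    show ?thesis
    proof (cases "\<exists>e\<in>K\<^sub>1. - e \<notin> C")
      case True
      then obtain e where "e \<in> K\<^sub>1" "- e \<notin> C" by blast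
      then obtain v where v: "v \<in> K\<^sub>1" and "g v = v"
        by (rule unit_section_fixed_point[OF K(2,3) S contg \<open>compact C\<close> gC \<open>C \<subseteq> K\<^sub>1\<close>])
      define c where "c = norm (T (N v))"
      have "c > 0" using normT[OF v] \<tau>pos[OF v] unfolding c_def by linarith
      then have "T (N v) = c *\<^sub>R g v" by (simp add: g_def sgn_div_norm c_def)
      then have c: "T (N v) = c *\<^sub>R v" by (simp add: \<open>g v = v\<close>)
      \<comment> \<open>The functional \<open>J (T (N v))\<close> is evaluated at \<open>v\<close>
        in two ways: by its own duality relation and by \<open>radial\<close>. Comparison gives
        \<open>\<theta> c = \<theta> (\<tau> v)\<close>.\<close>
      have "\<theta> c * c = blinfun_apply (J (T (N v))) (T (N v))"
        by (simp add: pair c_def)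
      also have "\<dots> = c * blinfun_apply (J (T (N v))) v"
        by (simp add: c blinfun.scaleR_right)
      finally have \<theta>c: "\<theta> c = blinfun_apply (J (T (N v))) v" using \<open>c > 0\<close> by simp
      have "\<tau> v * \<theta> (\<tau> v) = blinfun_apply (J (T (N v))) (N v)"
        by (simp add: JT blinfun.diff_left radial[OF v] pair nN[OF v])
      also have "\<dots> = \<tau> v * \<theta> c"
        by (simp add: \<theta>c N_def[of v] blinfun.scaleR_right)
      finally have "\<theta> (\<tau> v) = \<theta> c" using \<tau>pos[OF v] by simp
      then have "c = \<tau> v"
        using strict_mono_on_eqD[OF mono] \<open>c > 0\<close> \<tau>pos[OF v] by (simp add: less_imp_le)
      then show ?thesis using v c by (auto simp: N_def)
    next
      case False
      \<comment> \<open>The case assumption is used twice: for \<open>e\<close> it puts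
        \<open>- e\<close> into \<open>K\<^sub>1\<close>, and for \<open>- e\<close> it puts
        \<open>e\<close> into \<open>C\<close>.\<close>
      have "K\<^sub>1 \<subseteq> C"
      proof
        fix e assume "e \<in> K\<^sub>1"
        with False \<open>C \<subseteq> K\<^sub>1\<close> have "- e \<in> K\<^sub>1" by blast
        with False have "- (- e) \<in> C" by blast
        then show "e \<in> C" by simp
      qed
      then have "compact K\<^sub>1" using \<open>compact C\<close> \<open>C \<subseteq> K\<^sub>1\<close> by (simp add: subset_antisym)
      obtain k where "k \<in> K" "k \<noteq> 0" using K(4) by blast
      then have "sgn k \<in> K\<^sub>1" using \<open>cone K\<close> by (auto simp: S sgn_div_norm cone_def)
      then have "K\<^sub>1 \<noteq> {}" by blast
      moreover have "continuous_on K\<^sub>1 (\<lambda>v. E (N v))"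
        by (intro continuous_on_compose2[OF contE contN]) auto
      ultimately obtain v where v: "v \<in> K\<^sub>1" and min: "\<forall>w\<in>K\<^sub>1. E (N v) \<le> E (N w)"
        using continuous_attains_inf[OF \<open>compact K\<^sub>1\<close>] by blast
      \<comment> \<open>The test direction is \<open>T (N v)\<close> because \<open>E' (N v)\<close>
        equals \<open>J (N v) - J (T (N v))\<close>; together with \<open>radial\<close>, minimality
        then reverses the monotonicity inequality of \<open>J\<close>.\<close>
      have "blinfun_apply (E' (N v)) (T (N v)) \<ge> 0"
        unfolding N_def[of v]
      proof (rule minimax_derivative_nonneg[OF deriv assms(8) K(2,3) S cont\<tau> v])
        show "T (\<tau> v *\<^sub>R v) \<in> K" using TK[OF NK[OF v]] by (simp add: N_def)
        show "0 \<le> r\<^sub>0" "r\<^sub>0 < \<tau> v" "\<tau> v < R\<^sub>0" using bounds[OF v] \<open>0 < r\<^sub>0\<close> by auto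
        show "E (t *\<^sub>R v) \<le> E (\<tau> v *\<^sub>R v)" if "r\<^sub>0 < t" "t < R\<^sub>0" for t
          using that by (intro max[OF v] I) auto
        show "E (\<tau> v *\<^sub>R v) \<le> E (\<tau> w *\<^sub>R w)" if "w \<in> K\<^sub>1" for w
          using min that by (simp add: N_def)
      qed
      then have "blinfun_apply (J (T (N v)) - J (N v)) (T (N v) - N v) \<le> 0"
        by (simp add: JT blinfun.diff_right blinfun.minus_left radial[OF v])
      then have "T (N v) = N v"
        by (rule duality_mapping_strictly_monotone[OF mono assms(3) bij_is_inj[OF \<open>bij J\<close>]])
      with v show ?thesis by blast
    qed
  qed

  \<comment> \<open>From the fixed point to the critical point and its maximality along the
    ray\<close>
  then obtain v where v: "v \<in> K\<^sub>1" and fixed: "T (N v) = N v" by blast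
  have crit: "E' (N v) = 0" using JT[of "N v"] by (simp add: fixed)
  have less: "ereal (\<tau> v) < R"
    using bounds[OF v] \<open>ereal R\<^sub>0 \<le> R\<close> by (metis less_ereal.simps(1) order_less_le_trans)
  show ?thesis
  proof (intro bexI conjI)
    show "N v \<in> U\<^sub>b" using v assms(24) by (auto simp: N_def)
    show "E' (N v) = 0" by (rule crit)
    show "N v \<in> K" by (rule NK[OF v])
    show "r < norm (N v)" "ereal (norm (N v)) < R"
      using nN[OF v] bounds[OF v] \<open>r \<le> r\<^sub>0\<close> less by auto
    have "E (t *\<^sub>R v) \<le> E (\<tau> v *\<^sub>R v)" if "r < t" "ereal t < R" for t
      using that by (intro max[OF v]) (simp add: I_def)
    moreover have "N v /\<^sub>R norm (N v) = v" using sgnN[OF v] by (simp add: sgn_div_norm)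
    ultimately show "is_arg_max (\<lambda>t. E (t *\<^sub>R (N v /\<^sub>R norm (N v)))) (\<lambda>t. r < t \<and> ereal t < R) (norm (N v))"
      using nN[OF v] bounds[OF v] \<open>r \<le> r\<^sub>0\<close> less
      by (fastforce simp: is_arg_max_def not_less[symmetric])
  qed
qed

end
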